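(* Let $\Bbbk$ be an algebraically closed field with $\operatorname{char}(\Bbbk)\neq 2$, let $\mu_{ij}\in\Bbbk^\times$ ($1\le i,j\le 3$) satisfy $\mu_{ii}=1$ and $\mu_{ij}\mu_{ji}=1$ for all $i,j$, and let $S$ be the graded $\Bbbk$-algebra on degree-one generators $z_1,z_2,z_3$ with defining relations $z_jz_i=\mu_{ij}z_iz_j$ for all $i,j$. Let $Q=az_1^2+bz_2^2+cz_3^2+2dz_1z_2+2ez_1z_3+2fz_2z_3\in S_2$, where $a,\ldots,f\in\Bbbk$, and let $$M=\begin{bmatrix} a & d & e\\ \mu_{21}d & b & f\\ \mu_{31}e & \mu_{32}f & c\end{bmatrix}$$ be the $\mu$-symmetric matrix associated to $Q$. Let $D_1(M),\ldots,D_8(M)$ be as defined in the context. Then: (a) There exists $L\in S_1$ such that $Q=L^2$ if and only if $D_i(M)=0$ for all $i=1,\ldots,6$. (b)(i) If $a=0$, then there exist $L_1,L_2\in S_1$ such that $Q=L_1L_2$ if and only if $D_7(M)=0$. (b)(ii) If $a\neq 0$, then there exist $L_1,L_2\in S_1$ such that $Q=L_1L_2$ if and only if $D_8(M)=0$ for some $X,Y\in\Bbbk$ satisfying $X^2=d^2-\mu_{12}ab$ and $Y^2=e^2-\mu_{13}ac$.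
   Context: $S_i$ denotes the span of the homogeneous elements of $S$ of degree $i$; $S_2$ has basis $z_1^2,z_2^2,z_3^2,z_1z_2,z_1z_3,z_2z_3$. For $M$ with entries $a,\dots,f$ as displayed in the claim, define $D_1(M)=4d^2-(1+\mu_{12})^2ab$, $D_2(M)=4e^2-(1+\mu_{13})^2ac$, $D_3(M)=4f^2-(1+\mu_{23})^2bc$, $D_4(M)=2(1+\mu_{23})de-(1+\mu_{12})(1+\mu_{13})af$, $D_5(M)=2(1+\mu_{12})ef-(1+\mu_{13})(1+\mu_{23})cd$, $D_6(M)=2(1+\mu_{13})df-(1+\mu_{12})(1+\mu_{23})be$, $D_7(M)=(\mu_{23}cd^2-2def+be^2)(\mu_{13}\mu_{21}cd^2-2def+\mu_{12}\mu_{23}\mu_{31}be^2)$, $D_8(M)=\mu_{21}(d+X)(e-Y)+\mu_{23}\mu_{31}(d-X)(e+Y)-2af$, where in $D_8$ the elements $X,Y\in\Bbbk$ satisfy $X^2=d^2-\mu_{12}ab$ and $Y^2=e^2-\mu_{13}ac$ (so the value of $D_8(M)$ depends on the choice of the square roots $X,Y$). *)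

theory Defs
  imports
    "HOL-Analysis.Cartesian_Space"
    "HOL-Library.Poly_Mapping"
    "HOL-Computational_Algebra.Polynomial"
    "HOL-Algebra.QuotRing"
begin

text \<open>
  The free monoid on \<open>'i\<close>. A copy of the list type is used because \<^class>\<open>monoid_add\<close> is what
  \<^typ>\<open>('m, 'k) poly_mapping\<close> needs in order to be a ring under convolution.
\<close>

datatype 'i free_monoid = Word (letters: "'i list")

instantiation free_monoid :: (type) monoid_add
begin

definition zero_free_monoid :: "'a free_monoid"
  where "0 = Word []"

definition plus_free_monoid :: "'a free_monoid \<Rightarrow> 'a free_monoid \<Rightarrow> 'a free_monoid"
  where "u + v = Word (letters u @ letters v)"

instance
  by standard (simp_all add: zero_free_monoid_def plus_free_monoid_def)

end

text \<open>The monoid algebra of the free monoid is the free associative algebra.\<close>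

type_synonym ('i, 'k) free_algebra = "'i free_monoid \<Rightarrow>\<^sub>0 'k"

definition scalar :: "'k \<Rightarrow> ('i, 'k::ring_1) free_algebra"
  where "scalar r = Poly_Mapping.single 0 r"

definition gen :: "'i \<Rightarrow> ('i, 'k::ring_1) free_algebra"
  where "gen i = Poly_Mapping.single (Word [i]) 1"

definition homogeneous :: "nat \<Rightarrow> ('i, 'k::ring_1) free_algebra \<Rightarrow> bool"
  where "homogeneous n p \<longleftrightarrow> (\<forall>w \<in> Poly_Mapping.keys p. length (letters w) = n)"

definition skew_relations :: "('i \<Rightarrow> 'i \<Rightarrow> 'k) \<Rightarrow> ('i, 'k::field) free_algebra set"
  where "skew_relations \<mu> = {gen j * gen i - scalar (\<mu> i j) * gen i * gen j | i j. True}"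

text \<open>
  Counterpart of the library's \<open>ring_of_type_algebra\<close>, whose theory would bring in conflicting
  notation for \<open>$\<close> and \<open>X\<close>.
\<close>

definition free_algebra_ring :: "('i, 'k::ring_1) free_algebra ring"
  where "free_algebra_ring =
    \<lparr>carrier = UNIV, monoid.mult = (*), one = 1, ring.zero = 0, add = (+)\<rparr>"

text \<open>\<^const>\<open>genideal\<close> is the two-sided ideal generated by a set.\<close>

definition skew_ideal :: "('i \<Rightarrow> 'i \<Rightarrow> 'k) \<Rightarrow> ('i, 'k::field) free_algebra set"
  where "skew_ideal \<mu> = genideal free_algebra_ring (skew_relations \<mu>)"

definition skew_algebra :: "('i \<Rightarrow> 'i \<Rightarrow> 'k) \<Rightarrow> ('i, 'k::field) free_algebra set ring"
  where "skew_algebra \<mu> = free_algebra_ring Quot skew_ideal \<mu>"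

definition skew_class ::
    "('i \<Rightarrow> 'i \<Rightarrow> 'k) \<Rightarrow> ('i, 'k::field) free_algebra \<Rightarrow> ('i, 'k) free_algebra set"
  where "skew_class \<mu> p = a_r_coset free_algebra_ring (skew_ideal \<mu>) p"

text \<open>The relations are homogeneous, so the grading of the free algebra descends to the quotient.\<close>

definition skew_part :: "('i \<Rightarrow> 'i \<Rightarrow> 'k) \<Rightarrow> nat \<Rightarrow> ('i, 'k::field) free_algebra set set"
  where "skew_part \<mu> n = skew_class \<mu> ` {p. homogeneous n p}"

text \<open>
  Indices range over the three-element type \<open>3\<close>, whose elements are \<open>1\<close>, \<open>2\<close> and \<open>3\<close>
  (the last one coincides with \<open>0\<close>).
\<close>

definition quadratic_form ::
    "(3 \<Rightarrow> 3 \<Rightarrow> 'k) \<Rightarrow> 'k \<Rightarrow> 'k \<Rightarrow> 'k \<Rightarrow> 'k \<Rightarrow> 'k \<Rightarrow> 'k \<Rightarrow> (3, 'k::field) free_algebra set"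
  where "quadratic_form \<mu> a b c d e f = skew_class \<mu>
    (scalar a * gen 1 ^ 2 + scalar b * gen 2 ^ 2 + scalar c * gen 3 ^ 2
     + scalar (2 * d) * gen 1 * gen 2 + scalar (2 * e) * gen 1 * gen 3
     + scalar (2 * f) * gen 2 * gen 3)"

definition mu_symmetric_matrix ::
    "(3 \<Rightarrow> 3 \<Rightarrow> 'k) \<Rightarrow> 'k \<Rightarrow> 'k \<Rightarrow> 'k \<Rightarrow> 'k \<Rightarrow> 'k \<Rightarrow> 'k \<Rightarrow> 'k::field ^ 3 ^ 3"
  where "mu_symmetric_matrix \<mu> a b c d e f = vector
    [vector [a, d, e],
     vector [\<mu> 2 1 * d, b, f],
     vector [\<mu> 3 1 * e, \<mu> 3 2 * f, c]]"

definition D1 :: "(3 \<Rightarrow> 3 \<Rightarrow> 'k) \<Rightarrow> 'k::field ^ 3 ^ 3 \<Rightarrow> 'k"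
  where "D1 \<mu> M = (let a = M$1$1; b = M$2$2; d = M$1$2 in
    4 * d^2 - (1 + \<mu> 1 2)^2 * a * b)"

definition D2 :: "(3 \<Rightarrow> 3 \<Rightarrow> 'k) \<Rightarrow> 'k::field ^ 3 ^ 3 \<Rightarrow> 'k"
  where "D2 \<mu> M = (let a = M$1$1; c = M$3$3; e = M$1$3 in
    4 * e^2 - (1 + \<mu> 1 3)^2 * a * c)"

definition D3 :: "(3 \<Rightarrow> 3 \<Rightarrow> 'k) \<Rightarrow> 'k::field ^ 3 ^ 3 \<Rightarrow> 'k"
  where "D3 \<mu> M = (let b = M$2$2; c = M$3$3; f = M$2$3 in
    4 * f^2 - (1 + \<mu> 2 3)^2 * b * c)"

definition D4 :: "(3 \<Rightarrow> 3 \<Rightarrow> 'k) \<Rightarrow> 'k::field ^ 3 ^ 3 \<Rightarrow> 'k"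
  where "D4 \<mu> M = (let a = M$1$1; d = M$1$2; e = M$1$3; f = M$2$3 in
    2 * (1 + \<mu> 2 3) * d * e - (1 + \<mu> 1 2) * (1 + \<mu> 1 3) * a * f)"

definition D5 :: "(3 \<Rightarrow> 3 \<Rightarrow> 'k) \<Rightarrow> 'k::field ^ 3 ^ 3 \<Rightarrow> 'k"
  where "D5 \<mu> M = (let c = M$3$3; d = M$1$2; e = M$1$3; f = M$2$3 in
    2 * (1 + \<mu> 1 2) * e * f - (1 + \<mu> 1 3) * (1 + \<mu> 2 3) * c * d)"

definition D6 :: "(3 \<Rightarrow> 3 \<Rightarrow> 'k) \<Rightarrow> 'k::field ^ 3 ^ 3 \<Rightarrow> 'k"
  where "D6 \<mu> M = (let b = M$2$2; d = M$1$2; e = M$1$3; f = M$2$3 in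
    2 * (1 + \<mu> 1 3) * d * f - (1 + \<mu> 1 2) * (1 + \<mu> 2 3) * b * e)"

definition D7 :: "(3 \<Rightarrow> 3 \<Rightarrow> 'k) \<Rightarrow> 'k::field ^ 3 ^ 3 \<Rightarrow> 'k"
  where "D7 \<mu> M = (let b = M$2$2; c = M$3$3; d = M$1$2; e = M$1$3; f = M$2$3 in
    (\<mu> 2 3 * c * d^2 - 2 * d * e * f + b * e^2)
    * (\<mu> 1 3 * \<mu> 2 1 * c * d^2 - 2 * d * e * f + \<mu> 1 2 * \<mu> 2 3 * \<mu> 3 1 * b * e^2))"

text \<open>\<open>X\<close> and \<open>Y\<close> stand for chosen square roots of \<open>d\<^sup>2 - \<mu>\<^sub>1\<^sub>2 a b\<close> and \<open>e\<^sup>2 - \<mu>\<^sub>1\<^sub>3 a c\<close>.\<close>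

definition D8 :: "(3 \<Rightarrow> 3 \<Rightarrow> 'k) \<Rightarrow> 'k::field ^ 3 ^ 3 \<Rightarrow> 'k \<Rightarrow> 'k \<Rightarrow> 'k"
  where "D8 \<mu> M X Y = (let a = M$1$1; d = M$1$2; e = M$1$3; f = M$2$3 in
    \<mu> 2 1 * (d + X) * (e - Y) + \<mu> 2 3 * \<mu> 3 1 * (d - X) * (e + Y) - 2 * a * f)"

end

theory Submission
  imports Defs
begin

text \<open>
  In degree two the ideal of relations is cut out by the functionals sending \<open>p\<close> to
  \<open>p\<^bsub>ij\<^esub> + \<mu>\<^bsub>ij\<^esub> p\<^bsub>ji\<^esub>\<close>, where \<open>p\<^bsub>ij\<^esub>\<close> is the coefficient of \<open>z\<^sub>i z\<^sub>j\<close>. Comparing their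
  values on both sides turns \<open>Q = L\<^sub>1 L\<^sub>2\<close> into six scalar equations in the coefficients
  \<open>x\<^sub>1, y\<^sub>1, z\<^sub>1\<close> of \<open>L\<^sub>1\<close> and \<open>x\<^sub>2, y\<^sub>2, z\<^sub>2\<close> of \<open>L\<^sub>2\<close>. For squares, \<open>x, y, z\<close> are square roots of
  \<open>a, b, c\<close>, and the conditions \<open>D\<^sub>i\<close> say that their signs can be chosen compatibly. For products
  with \<open>a \<noteq> 0\<close>, the terms \<open>x\<^sub>1 y\<^sub>2\<close> and \<open>\<mu>\<^sub>1\<^sub>2 y\<^sub>1 x\<^sub>2\<close> have sum \<open>2d\<close> and product \<open>\<mu>\<^sub>1\<^sub>2 ab\<close>, so they are
  \<open>d \<mp> X\<close>; likewise \<open>x\<^sub>1 z\<^sub>2\<close> and \<open>\<mu>\<^sub>1\<^sub>3 z\<^sub>1 x\<^sub>2\<close> are \<open>e \<mp> Y\<close>, and the equation for \<open>2f\<close> becomes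
  \<open>D\<^sub>8 = 0\<close>. If \<open>a = 0\<close>, then \<open>x\<^sub>1 = 0\<close> or \<open>x\<^sub>2 = 0\<close>, and the two factors of \<open>D\<^sub>7\<close> correspond to
  these two cases.
\<close>

section \<open>Coefficients of products in the free algebra\<close>

text \<open>A factorisation of a word in the free monoid is a choice of cut position. Given the
  prefix the suffix is unique, so the inner convolution sum has one term; the outer sum is supported
  on the prefixes of \<open>w\<close>, which are distinct because their lengths are.\<close>

lemma lookup_times_Word:
  fixes p q :: "('i, 'k::ring_1) free_algebra"
  shows "Poly_Mapping.lookup (p * q) (Word w) =
    (\<Sum>n\<le>length w. Poly_Mapping.lookup p (Word (take n w)) * Poly_Mapping.lookup q (Word (drop n w)))"
proof -
  let ?A = "(\<lambda>n. Word (take n w)) ` {..length w}"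
  let ?g = "\<lambda>u. Poly_Mapping.lookup p u * Sum_any (\<lambda>v. Poly_Mapping.lookup q v when Word w = u + v)"
  have inner: "Sum_any (\<lambda>v. Poly_Mapping.lookup q v when Word w = Word (take n w) + v)
      = Poly_Mapping.lookup q (Word (drop n w))" for n
  proof -
    have "Word w = Word (take n w) + v \<longleftrightarrow> v = Word (drop n w)" for v
      using same_append_eq[of "take n w" "drop n w" "letters v"]
      by (cases v) (auto simp: plus_free_monoid_def)
    then show ?thesis
      by simp
  qed
  have outer: "{u. ?g u \<noteq> 0} \<subseteq> ?A"
  proof
    fix u assume "u \<in> {u. ?g u \<noteq> 0}"
    then have "Sum_any (\<lambda>v. Poly_Mapping.lookup q v when Word w = u + v) \<noteq> 0"
      by (metis (mono_tags, lifting) mem_Collect_eq mult_zero_right)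
    then obtain v where "Word w = u + v"
      by (metis (mono_tags, lifting) Sum_any.not_neutral_obtains_not_neutral when_neq_zero)
    then have w: "w = letters u @ letters v"
      by (simp add: plus_free_monoid_def)
    show "u \<in> ?A"
      by (rule image_eqI[of _ _ "length (letters u)"]) (simp_all add: w)
  qed
  have inj: "inj_on (\<lambda>n. Word (take n w)) {..length w}"
    by (rule inj_onI) (auto dest: arg_cong[where f = length])
  have "Poly_Mapping.lookup (p * q) (Word w) = sum ?g ?A"
    unfolding lookup_mult by (rule Sum_any.expand_superset[OF _ outer]) simp
  then show ?thesis
    unfolding sum.reindex[OF inj] by (simp add: inner)
qed

lemma lookup_times_Word_le2:
  fixes p q :: "('i, 'k::ring_1) free_algebra"
  shows "Poly_Mapping.lookup (p * q) (Word []) =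
      Poly_Mapping.lookup p (Word []) * Poly_Mapping.lookup q (Word [])"
    and "Poly_Mapping.lookup (p * q) (Word [i]) =
      Poly_Mapping.lookup p (Word []) * Poly_Mapping.lookup q (Word [i])
      + Poly_Mapping.lookup p (Word [i]) * Poly_Mapping.lookup q (Word [])"
    and "Poly_Mapping.lookup (p * q) (Word [i, j]) =
      Poly_Mapping.lookup p (Word []) * Poly_Mapping.lookup q (Word [i, j])
      + Poly_Mapping.lookup p (Word [i]) * Poly_Mapping.lookup q (Word [j])
      + Poly_Mapping.lookup p (Word [i, j]) * Poly_Mapping.lookup q (Word [])"
  by (simp_all add: lookup_times_Word)

section \<open>Ideals and cosets in the free algebra\<close>

lemma ring_free_algebra: "ring (free_algebra_ring :: ('i, 'k::ring_1) free_algebra ring)"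
proof (rule ringI)
  show "abelian_group (free_algebra_ring :: ('i, 'k) free_algebra ring)"
    by (rule abelian_groupI)
      (auto simp: free_algebra_ring_def algebra_simps intro: right_minus)
  show "monoid (free_algebra_ring :: ('i, 'k) free_algebra ring)"
    by (rule monoidI) (auto simp: free_algebra_ring_def mult.assoc)
qed (auto simp: free_algebra_ring_def algebra_simps)

lemma a_inv_free_algebra_ring:
  "\<ominus>\<^bsub>free_algebra_ring\<^esub> p = - (p :: ('i, 'k::ring_1) free_algebra)"
  by (rule abelian_group.minus_equality[OF ring.is_abelian_group[OF ring_free_algebra]])
    (simp_all add: free_algebra_ring_def)

lemma ideal_free_algebra_ringI:
  fixes J :: "('i, 'k::ring_1) free_algebra set"
  assumes "0 \<in> J" "\<And>p q. p \<in> J \<Longrightarrow> q \<in> J \<Longrightarrow> p + q \<in> J" "\<And>p. p \<in> J \<Longrightarrow> - p \<in> J"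
    "\<And>p q. p \<in> J \<Longrightarrow> q * p \<in> J" "\<And>p q. p \<in> J \<Longrightarrow> p * q \<in> J"
  shows "ideal J free_algebra_ring"
proof (rule idealI[OF ring_free_algebra])
  interpret free_algebra: ring "free_algebra_ring :: ('i, 'k) free_algebra ring"
    by (rule ring_free_algebra)
  show "subgroup J (add_monoid free_algebra_ring)"
  proof (rule free_algebra.add.subgroupI)
    show "J \<subseteq> carrier free_algebra_ring"
      by (simp add: free_algebra_ring_def)
    show "J \<noteq> {}"
      using assms(1) by blast
    show "p \<oplus>\<^bsub>free_algebra_ring\<^esub> q \<in> J" if "p \<in> J" "q \<in> J" for p q
      using assms(2)[OF that] by (simp add: free_algebra_ring_def)
    show "\<ominus>\<^bsub>free_algebra_ring\<^esub> p \<in> J" if "p \<in> J" for p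
      using assms(3)[OF that] by (simp add: a_inv_free_algebra_ring)
  qed
qed (use assms in \<open>simp_all add: free_algebra_ring_def\<close>)

context
  fixes I :: "('i, 'k::ring_1) free_algebra set"
  assumes I: "ideal I free_algebra_ring"
begin

interpretation ideal I free_algebra_ring
  by (rule I)

lemma free_algebra_ideal_closed:
  shows "0 \<in> I" "p \<in> I \<Longrightarrow> q \<in> I \<Longrightarrow> p + q \<in> I" "p \<in> I \<Longrightarrow> - p \<in> I" "p \<in> I \<Longrightarrow> r * p \<in> I"
  using additive_subgroup.zero_closed[OF is_additive_subgroup]
    additive_subgroup.a_closed[OF is_additive_subgroup]
    additive_subgroup.a_inv_closed[OF is_additive_subgroup] I_l_closed
  unfolding a_inv_free_algebra_ring by (simp_all add: free_algebra_ring_def)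

lemma free_algebra_ideal_sum: "(\<And>x. x \<in> A \<Longrightarrow> g x \<in> I) \<Longrightarrow> sum g A \<in> I"
  by (induction A rule: infinite_finite_induct) (simp_all add: free_algebra_ideal_closed)

lemma mem_free_algebra_coset: "p \<in> a_r_coset free_algebra_ring I q \<longleftrightarrow> p - q \<in> I"
proof -
  have "p \<in> a_r_coset free_algebra_ring I q \<longleftrightarrow> (\<exists>h\<in>I. p = h + q)"
    by (simp add: a_r_coset_def' free_algebra_ring_def)
  also have "\<dots> \<longleftrightarrow> p - q \<in> I"
    by (metis diff_add_cancel add_diff_cancel_right')
  finally show ?thesis .
qed

lemma free_algebra_coset_eq_iff:
  "a_r_coset free_algebra_ring I p = a_r_coset free_algebra_ring I q \<longleftrightarrow> p - q \<in> I"
proof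
  assume "a_r_coset free_algebra_ring I p = a_r_coset free_algebra_ring I q"
  then show "p - q \<in> I"
    by (metis mem_free_algebra_coset diff_self free_algebra_ideal_closed(1))
next
  assume pq: "p - q \<in> I"
  have "x - p \<in> I \<longleftrightarrow> x - q \<in> I" for x
    using free_algebra_ideal_closed(2)[of "x - p" "p - q"]
      free_algebra_ideal_closed(2)[of "x - q" "- (p - q)"] free_algebra_ideal_closed(3)[OF pq] pq
    by auto
  then show "a_r_coset free_algebra_ring I p = a_r_coset free_algebra_ring I q"
    by (auto simp: mem_free_algebra_coset)
qed

end

section \<open>Arithmetic in the skew polynomial algebra\<close>

lemma ideal_skew_ideal: "ideal (skew_ideal \<mu>) free_algebra_ring"
  unfolding skew_ideal_def
  by (rule ring.genideal_ideal[OF ring_free_algebra]) (simp add: free_algebra_ring_def)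

lemma skew_class_eq_iff: "skew_class \<mu> p = skew_class \<mu> q \<longleftrightarrow> p - q \<in> skew_ideal \<mu>"
  unfolding skew_class_def by (rule free_algebra_coset_eq_iff[OF ideal_skew_ideal])

lemma skew_class_mult:
  "skew_class \<mu> p \<otimes>\<^bsub>skew_algebra \<mu>\<^esub> skew_class \<mu> q = skew_class \<mu> (p * q)"
  using ideal.rcoset_mult_add[OF ideal_skew_ideal, of p q \<mu>]
  by (simp add: skew_class_def skew_algebra_def FactRing_def free_algebra_ring_def)

lemma skew_class_power2:
  "skew_class \<mu> p [^]\<^bsub>skew_algebra \<mu>\<^esub> (2::nat) = skew_class \<mu> (p * p)"
proof -
  interpret ring "skew_algebra \<mu>"
    unfolding skew_algebra_def by (rule ideal.quotient_is_ring[OF ideal_skew_ideal])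
  have "skew_class \<mu> p \<in> carrier (skew_algebra \<mu>)"
    by (auto simp: skew_class_def skew_algebra_def FactRing_def A_RCOSETS_def' free_algebra_ring_def)
  then show ?thesis
    by (simp add: numeral_2_eq_2 skew_class_mult)
qed

section \<open>The ideal of relations in degree two\<close>

lemma skew_relation_eq:
  "gen j * gen i - scalar m * gen i * gen j =
    Poly_Mapping.single (Word [j, i]) 1 - Poly_Mapping.single (Word [i, j]) m"
  by (simp add: gen_def scalar_def mult_single plus_free_monoid_def zero_free_monoid_def)

text \<open>
  On elements without terms of degree below two, multiplication by \<open>q\<close> from either side scales the
  coefficients of degree two by the constant term of \<open>q\<close>.
\<close>

lemma lookup_skew_ideal:
  assumes inv: "\<And>i j. \<mu> i j * \<mu> j i = 1" and "p \<in> skew_ideal \<mu>"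
  shows "Poly_Mapping.lookup p (Word [i, j]) + \<mu> i j * Poly_Mapping.lookup p (Word [j, i]) = 0"
proof -
  let ?s = "\<lambda>p i j. Poly_Mapping.lookup p (Word [i, j]) + \<mu> i j * Poly_Mapping.lookup p (Word [j, i])"
  \<comment> \<open>The ideal generated by the relations is the least one containing them, so it
    suffices that \<open>J\<close> is an ideal and contains every relation.\<close>
  define J where "J = {p :: ('a, 'b) free_algebra. Poly_Mapping.lookup p (Word []) = 0 \<and>
    (\<forall>i. Poly_Mapping.lookup p (Word [i]) = 0) \<and> (\<forall>i j. ?s p i j = 0)}"
  have "ideal J free_algebra_ring"
  proof (rule ideal_free_algebra_ringI)
    show "0 \<in> J"
      by (simp add: J_def)
  next
    fix p q assume pq: "p \<in> J" "q \<in> J"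
    have "?s (p + q) i j = ?s p i j + ?s q i j" for i j
      by (simp add: lookup_add algebra_simps)
    also have "?s p i j + ?s q i j = 0" for i j
      using pq by (simp add: J_def)
    finally show "p + q \<in> J"
      using pq by (simp add: J_def lookup_add)
  next
    fix p q assume p: "p \<in> J"
    then have low: "Poly_Mapping.lookup p (Word []) = 0" "\<And>i. Poly_Mapping.lookup p (Word [i]) = 0"
      by (simp_all add: J_def)
    have "?s (- p) i j = - ?s p i j" for i j
      by simp
    also have "- ?s p i j = 0" for i j
      using p by (simp only: J_def mem_Collect_eq minus_zero)
    finally have neg: "?s (- p) i j = 0" for i j .
    show "- p \<in> J"
      unfolding J_def by (rule CollectI, intro conjI allI neg) (simp_all add: low)
    have "?s (q * p) i j = Poly_Mapping.lookup q (Word []) * ?s p i j" for i j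
      by (simp add: lookup_times_Word_le2 low algebra_simps)
    also have "Poly_Mapping.lookup q (Word []) * ?s p i j = 0" for i j
      using p by (simp only: J_def mem_Collect_eq mult_zero_right)
    finally show "q * p \<in> J"
      unfolding J_def mem_Collect_eq by (simp add: lookup_times_Word_le2 low)
    have "?s (p * q) i j = ?s p i j * Poly_Mapping.lookup q (Word [])" for i j
      by (simp add: lookup_times_Word_le2 low algebra_simps)
    also have "?s p i j * Poly_Mapping.lookup q (Word []) = 0" for i j
      using p by (simp only: J_def mem_Collect_eq mult_zero_left)
    finally show "p * q \<in> J"
      unfolding J_def mem_Collect_eq by (simp add: lookup_times_Word_le2 low)
  qed
  moreover have "skew_relations \<mu> \<subseteq> J"
  proof
    fix p assume "p \<in> skew_relations \<mu>"
    then obtain i j where p: "p = Poly_Mapping.single (Word [j, i]) 1 - Poly_Mapping.single (Word [i, j]) (\<mu> i j)"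
      unfolding skew_relations_def skew_relation_eq by blast
    have "Poly_Mapping.lookup p (Word [k, l]) + \<mu> k l * Poly_Mapping.lookup p (Word [l, k]) = 0" for k l
    proof -
      \<comment> \<open>The functional takes the value 1 - \<mu> j i * \<mu> i j in the first case
        and -\<mu> i j + \<mu> i j in the second. If i = j, the two words coincide and the value is
        (1 - \<mu> i i) * (1 + \<mu> i i), which vanishes by \<open>inv\<close> too.\<close>
      consider "k = j \<and> l = i" | "k = i \<and> l = j" | "\<not> (k = j \<and> l = i)" "\<not> (k = i \<and> l = j)"
        by blast
      then show ?thesis
      proof cases
        case 1
        then show ?thesis
          by (cases "i = j") (simp_all add: p lookup_minus lookup_single inv right_diff_distrib)
      next
        case 2
        then show ?thesis
          by (cases "i = j") (simp_all add: p lookup_minus lookup_single inv right_diff_distrib)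
      next
        case 3
        then have "[j, i] \<noteq> [k, l]" "[i, j] \<noteq> [k, l]" "[j, i] \<noteq> [l, k]" "[i, j] \<noteq> [l, k]"
          by auto
        then show ?thesis
          by (simp add: p lookup_minus lookup_single)
      qed
    qed
    then show "p \<in> J"
      by (simp add: J_def) (simp add: p lookup_minus lookup_single)
  qed
  ultimately have "skew_ideal \<mu> \<subseteq> J"
    unfolding skew_ideal_def by (rule ring.genideal_minimal[OF ring_free_algebra])
  then show ?thesis
    using assms(2) unfolding J_def by blast
qed

lemma mem_skew_idealI:
  fixes \<mu> :: "'i::finite \<Rightarrow> 'i \<Rightarrow> 'k::field"
  assumes two: "(2::'k) \<noteq> 0" and p: "homogeneous 2 p"
    and eq: "\<And>i j. Poly_Mapping.lookup p (Word [i, j]) + \<mu> i j * Poly_Mapping.lookup p (Word [j, i]) = 0"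
  shows "p \<in> skew_ideal \<mu>"
proof -
  \<comment> \<open>As \<open>p\<^bsub>ij\<^esub> = - \<mu>\<^bsub>ij\<^esub> p\<^bsub>ji\<^esub>\<close>, symmetrising the double sum over \<open>p\<^bsub>ij\<^esub> z\<^sub>i z\<^sub>j\<close> expresses \<open>2p\<close> by the relations.\<close>
  define r where "r = (\<lambda>(i, j). gen j * gen i - scalar (\<mu> i j) * gen i * gen j)"
  \<comment> \<open>The indices are swapped because \<open>r (i, j)\<close> has coefficient 1 at the
    word z_j z_i.\<close>
  define h where "h = (\<lambda>(i, j). Poly_Mapping.lookup p (Word [j, i]) / 2)"
  have "p = (\<Sum>x\<in>UNIV. scalar (h x) * r x)"
  proof (rule poly_mapping_eqI)
    fix u :: "'i free_monoid"
    obtain w where u: "u = Word w"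
      by (cases u)
    have "Poly_Mapping.lookup (scalar (h x) * r x) u =
        (if [snd x, fst x] = w then h x else 0)
        - (if [fst x, snd x] = w then h x * \<mu> (fst x) (snd x) else 0)" for x
    proof -
      have "r x = Poly_Mapping.single (Word [snd x, fst x]) 1
          - Poly_Mapping.single (Word [fst x, snd x]) (\<mu> (fst x) (snd x))"
        by (simp add: r_def skew_relation_eq split: prod.split)
      then show ?thesis
        by (simp add: u right_diff_distrib scalar_def mult_single lookup_minus lookup_single
            zero_free_monoid_def plus_free_monoid_def when_def)
    qed
    then have s: "Poly_Mapping.lookup (\<Sum>x\<in>UNIV. scalar (h x) * r x) u =
        (\<Sum>x\<in>UNIV. if [snd x, fst x] = w then h x else 0)
        - (\<Sum>x\<in>UNIV. if [fst x, snd x] = w then h x * \<mu> (fst x) (snd x) else 0)"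
      by (simp only: lookup_sum sum_subtractf)
    show "Poly_Mapping.lookup p u = Poly_Mapping.lookup (\<Sum>x\<in>UNIV. scalar (h x) * r x) u"
    proof (cases "length w = 2")
      case True
      then obtain k l where w: "w = [k, l]"
        by (auto simp: length_Suc_conv numeral_2_eq_2)
      have "[snd x, fst x] = w \<longleftrightarrow> x = (l, k)" "[fst x, snd x] = w \<longleftrightarrow> x = (k, l)" for x
        by (auto simp: w prod_eq_iff)
      then have "Poly_Mapping.lookup (\<Sum>x\<in>UNIV. scalar (h x) * r x) u =
          h (l, k) - h (k, l) * \<mu> k l"
        unfolding s by simp
      also have "\<dots> = (Poly_Mapping.lookup p u - \<mu> k l * Poly_Mapping.lookup p (Word [l, k])) / 2"
        by (simp add: h_def u w diff_divide_distrib)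
      also have "\<mu> k l * Poly_Mapping.lookup p (Word [l, k]) = - Poly_Mapping.lookup p u"
        using eq[of k l] unfolding u w by (metis add.commute eq_neg_iff_add_eq_0)
      finally show ?thesis
        using two by (simp add: mult_2[symmetric])
    next
      case False
      then have "Poly_Mapping.lookup p u = 0"
        using p unfolding homogeneous_def u by (metis free_monoid.sel in_keys_iff)
      moreover have "[i, j] \<noteq> w" for i j
        using False by auto
      ultimately show ?thesis
        unfolding s by simp
    qed
  qed
  moreover have "r x \<in> skew_ideal \<mu>" for x
    unfolding skew_ideal_def
    by (rule subsetD[OF ring.genideal_self[OF ring_free_algebra]])
      (auto simp: free_algebra_ring_def skew_relations_def r_def split: prod.split)
  then have "(\<Sum>x\<in>UNIV. scalar (h x) * r x) \<in> skew_ideal \<mu>"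
    by (intro free_algebra_ideal_sum[OF ideal_skew_ideal]
        free_algebra_ideal_closed(4)[OF ideal_skew_ideal])
  ultimately show ?thesis
    by simp
qed

text \<open>The functionals vanish on the ideal, and in degree two they detect it, so applying them
  to \<open>p - q\<close> decides equality in the quotient without constructing a basis of
  S_2.\<close>

lemma skew_class_eq_iff_lookup:
  fixes \<mu> :: "'i::finite \<Rightarrow> 'i \<Rightarrow> 'k::field"
  assumes two: "(2::'k) \<noteq> 0" and inv: "\<And>i j. \<mu> i j * \<mu> j i = 1"
    and p: "homogeneous 2 p" and q: "homogeneous 2 q"
  shows "skew_class \<mu> p = skew_class \<mu> q \<longleftrightarrow>
    (\<forall>i j. Poly_Mapping.lookup p (Word [i, j]) + \<mu> i j * Poly_Mapping.lookup p (Word [j, i]) =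
       Poly_Mapping.lookup q (Word [i, j]) + \<mu> i j * Poly_Mapping.lookup q (Word [j, i]))"
proof -
  have pq: "homogeneous 2 (p - q)"
    using p q keys_diff[of p q] unfolding homogeneous_def by blast
  have "p - q \<in> skew_ideal \<mu> \<longleftrightarrow> (\<forall>i j. Poly_Mapping.lookup (p - q) (Word [i, j])
      + \<mu> i j * Poly_Mapping.lookup (p - q) (Word [j, i]) = 0)"
    (is "_ \<longleftrightarrow> ?r")
  proof
    assume "p - q \<in> skew_ideal \<mu>"
    from lookup_skew_ideal[OF inv this] show ?r
      by blast
  next
    assume ?r
    then show "p - q \<in> skew_ideal \<mu>"
      by (intro mem_skew_idealI[OF two pq]) blast
  qed
  moreover have "x - x' + m * (y - y') = 0 \<longleftrightarrow> x + m * y = x' + m * y'" for x x' y y' m :: 'k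
  proof -
    have "x - x' + m * (y - y') = (x + m * y) - (x' + m * y')"
      by (simp add: algebra_simps)
    then show ?thesis
      by (simp only: right_minus_eq)
  qed
  ultimately show ?thesis
    by (simp only: skew_class_eq_iff lookup_minus)
qed

section \<open>Solvability of the scalar systems\<close>

lemma square_root_exists:
  fixes a :: "'k::alg_closed_field"
  shows "\<exists>x. x^2 = a"
proof -
  have "\<exists>x. poly [:- a, 0, 1:] x = 0"
    by (rule alg_closed_imp_poly_has_root) simp
  then show ?thesis
    by (auto simp: power2_eq_square algebra_simps)
qed

lemma quadratic_root_exists:
  fixes a b c :: "'k::alg_closed_field"
  assumes "a \<noteq> 0"
  shows "\<exists>x. a * x^2 + b * x + c = 0"
proof -
  have "\<exists>x. poly [:c, b, a:] x = 0"
    using assms by (intro alg_closed_imp_poly_has_root) simp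
  then show ?thesis
    by (auto simp: power2_eq_square algebra_simps)
qed

lemma two_neq_0:
  assumes "CHAR('k::field) \<noteq> 2"
  shows "(2::'k) \<noteq> 0"
proof
  assume "(2::'k) = 0"
  then have "CHAR('k) dvd 2"
    using of_nat_eq_0_iff_char_dvd[of 2, where 'a = 'k] by simp
  then have "CHAR('k) = 1 \<or> CHAR('k) = 2"
    by (metis prime_nat_iff two_is_prime_nat)
  with assms show False
    by simp
qed

text \<open>Here \<open>u\<close>, \<open>v\<close>, \<open>w\<close> stand for 1 + \<mu> 1 2, 1 +
  \<mu> 1 3, 1 + \<mu> 2 3, any of which may vanish. For the converse, fix a root \<open>x\<close>
  of \<open>a\<close>; the first two conditions then allow \<open>y\<close> and \<open>z\<close> to
  be chosen with the right signs for \<open>2 * d\<close> and \<open>2 * e\<close>, and the third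
  determines \<open>2 * f\<close> up to sign.\<close>

lemma square_system_iff:
  fixes a b c d e f u v w :: "'k::alg_closed_field"
  assumes two: "(2::'k) \<noteq> 0"
  shows "(\<exists>x y z. a = x^2 \<and> b = y^2 \<and> c = z^2 \<and>
            2 * d = u * x * y \<and> 2 * e = v * x * z \<and> 2 * f = w * y * z) \<longleftrightarrow>
    4 * d^2 - u^2 * a * b = 0 \<and> 4 * e^2 - v^2 * a * c = 0 \<and> 4 * f^2 - w^2 * b * c = 0 \<and>
    2 * w * d * e - u * v * a * f = 0 \<and> 2 * u * e * f - v * w * c * d = 0 \<and>
    2 * v * d * f - u * w * b * e = 0"
    (is "?L \<longleftrightarrow> ?R")
proof
  assume ?L
  then obtain x y z where *: "a = x^2" "b = y^2" "c = z^2"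
      "2 * d = u * x * y" "2 * e = v * x * z" "2 * f = w * y * z"
    by blast
  \<comment> \<open>The system gives only the doubles of \<open>d\<close>, \<open>e\<close>,
    \<open>f\<close>, so each condition is written in terms of these; the mixed ones need an extra
    factor 2, cancelled at the end.\<close>
  have "4 * d^2 = (2 * d)^2" "4 * e^2 = (2 * e)^2" "4 * f^2 = (2 * f)^2"
    "2 * (2 * w * d * e - u * v * a * f) = w * (2 * d) * (2 * e) - u * v * a * (2 * f)"
    "2 * (2 * u * e * f - v * w * c * d) = u * (2 * e) * (2 * f) - v * w * c * (2 * d)"
    "2 * (2 * v * d * f - u * w * b * e) = v * (2 * d) * (2 * f) - u * w * b * (2 * e)"
    by (simp_all add: power_mult_distrib algebra_simps)
  then have "4 * d^2 - u^2 * a * b = 0" "4 * e^2 - v^2 * a * c = 0" "4 * f^2 - w^2 * b * c = 0"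
    "2 * (2 * w * d * e - u * v * a * f) = 0" "2 * (2 * u * e * f - v * w * c * d) = 0"
    "2 * (2 * v * d * f - u * w * b * e) = 0"
    unfolding * by (simp_all add: power_mult_distrib power2_eq_square)
  then show ?R
    using two by (simp del: right_diff_distrib_numeral)
next
  assume R: ?R
  obtain x where x: "a = x^2"
    using square_root_exists[of a] by metis
  have sign: "\<exists>t. s = t^2 \<and> 2 * g = n * r * t" if "4 * g^2 - n^2 * r^2 * s = 0" for g n r s :: 'k
  proof -
    obtain t where t: "s = t^2"
      using square_root_exists[of s] by metis
    have "(2 * g)^2 = (n * r * t)^2"
      using that t by (simp add: power_mult_distrib)
    then have "2 * g = n * r * t \<or> 2 * g = n * r * (- t)"
      unfolding power2_eq_iff by simp
    then show ?thesis
      using t by (metis power2_minus)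
  qed
  obtain y where y: "b = y^2" "2 * d = u * x * y"
    using sign[of d u x b] R x by auto
  obtain z where z: "c = z^2" "2 * e = v * x * z"
    using sign[of e v x c] R x by auto
  have "(2 * f)^2 = (w * y * z)^2"
    using R y z by (simp add: power_mult_distrib)
  then consider "2 * f = w * y * z" | "2 * f = - (w * y * z)"
    unfolding power2_eq_iff by blast
  then show ?L
  proof cases
    case 1
    then show ?thesis
      using x y z by blast
  next
    case 2
    \<comment> \<open>Negating \<open>z\<close> is harmless when \<open>v * x = 0\<close>, and
      negating \<open>y\<close> is harmless when \<open>u = 0\<close>; either corrects the sign of
      \<open>2 * f\<close>. Otherwise \<open>u * v * a\<close> is nonzero and the fourth condition
      forces the right sign.\<close>
    consider "x = 0 \<or> v = 0" | "u = 0" | "x \<noteq> 0" "u \<noteq> 0" "v \<noteq> 0"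
      by blast
    then show ?thesis
    proof cases
      case 1
      then show ?thesis
        using x y z 2 by (intro exI[of _ x] exI[of _ y] exI[of _ "- z"]) auto
    next
      case c: 2
      then show ?thesis
        using x y z 2 by (intro exI[of _ x] exI[of _ "- y"] exI[of _ z]) auto
    next
      case 3
      have "u * v * x^2 * (w * y * z) = w * (u * x * y) * (v * x * z)"
        by (simp add: power2_eq_square)
      also have "\<dots> = 2 * (2 * w * d * e)"
        unfolding y(2)[symmetric] z(2)[symmetric] by simp
      also have "\<dots> = u * v * x^2 * (2 * f)"
        using R x by simp
      finally have "u * v * x^2 * (w * y * z) = u * v * x^2 * (2 * f)" .
      then have "2 * f = w * y * z"
        using 3 by simp
      then show ?thesis
        using x y z by blast
    qed
  qed
qed

text \<open>This factors a form in z_2, z_3 alone. If \<open>b = 0\<close>, the generator z_3 splits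
  off on the left. Otherwise normalise \<open>y1 = 1\<close> and \<open>y2 = b\<close>; the mixed
  term gives \<open>z2 = 2 * f - r * b * z1\<close>, and \<open>c = z1 * z2\<close> becomes a
  quadratic equation for \<open>z1\<close> with leading coefficient \<open>r * b\<close>.\<close>

lemma binary_quadratic_factors:
  fixes b c f r :: "'k::alg_closed_field"
  assumes "r \<noteq> 0"
  shows "\<exists>y1 z1 y2 z2. b = y1 * y2 \<and> c = z1 * z2 \<and> 2 * f = y1 * z2 + r * z1 * y2"
proof (cases "b = 0")
  case True
  then show ?thesis
    using assms
    by (intro exI[of _ 0] exI[of _ 1] exI[of _ "2 * f / r"] exI[of _ c]) simp
next
  case False
  obtain z where "r * b * z^2 + (- 2 * f) * z + c = 0"
    using quadratic_root_exists[of "r * b" "- 2 * f" c] assms False by auto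
  then have "c = z * (2 * f - r * b * z)"
    by (simp add: algebra_simps power2_eq_square eq_neg_iff_add_eq_0)
  then show ?thesis
    by (intro exI[of _ 1] exI[of _ z] exI[of _ b] exI[of _ "2 * f - r * b * z"]) simp
qed

text \<open>Here \<open>p\<close>, \<open>q\<close>, \<open>r\<close> are \<mu> 1 2, \<mu> 1 3,
  \<mu> 2 3, with \<open>p'\<close>, \<open>q'\<close> inverse to \<open>p\<close>,
  \<open>q\<close>. If \<open>d = e = 0\<close>, the generator z_1 does not occur and the form is
  binary. Otherwise the factor containing z_1 is normalised to have coefficient 1 there, which fixes
  the other factor.\<close>

lemma product_system_iff_0:
  fixes b c d e f p q r :: "'k::alg_closed_field"
  assumes two: "(2::'k) \<noteq> 0" and pqr: "p \<noteq> 0" "q \<noteq> 0" "r \<noteq> 0"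
    and inv: "p * p' = 1" "q * q' = 1"
  shows "(\<exists>x1 y1 z1 x2 y2 z2. 0 = x1 * x2 \<and> b = y1 * y2 \<and> c = z1 * z2 \<and>
            2 * d = x1 * y2 + p * y1 * x2 \<and> 2 * e = x1 * z2 + q * z1 * x2 \<and>
            2 * f = y1 * z2 + r * z1 * y2) \<longleftrightarrow>
    (r * c * d^2 - 2 * d * e * f + b * e^2)
    * (q * p' * c * d^2 - 2 * d * e * f + p * r * q' * b * e^2) = 0"
    (is "?L \<longleftrightarrow> ?R")
proof -
  have p': "p' = 1 / p" "q' = 1 / q"
    using inv pqr by (simp_all add: field_simps)
  show ?thesis
  proof
    assume ?L
    then obtain x1 y1 z1 x2 y2 z2 where *: "0 = x1 * x2" "b = y1 * y2" "c = z1 * z2"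
        "2 * d = x1 * y2 + p * y1 * x2" "2 * e = x1 * z2 + q * z1 * x2"
        "2 * f = y1 * z2 + r * z1 * y2"
      by blast
    from *(1) consider "x1 = 0" | "x2 = 0"
      by auto
    then show ?R
    proof cases
      case 1
      \<comment> \<open>Multiplication by 4 makes \<open>d\<close>, \<open>e\<close>,
        \<open>f\<close> occur only doubled, as in the system.\<close>
      have "2 * (2 * (q * p' * c * d^2 - 2 * d * e * f + p * r * q' * b * e^2))
        = q * p' * c * (2 * d)^2 - (2 * d) * (2 * e) * (2 * f) + p * r * q' * b * (2 * e)^2"
        by (simp add: power2_eq_square algebra_simps)
      also have "\<dots> = 0"
        unfolding *(2-) 1 p' using pqr by (simp add: field_simps power2_eq_square)
      finally show ?thesis
        using two unfolding mult_eq_0_iff by blast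
    next
      case 2
      have "2 * (2 * (r * c * d^2 - 2 * d * e * f + b * e^2))
        = r * c * (2 * d)^2 - (2 * d) * (2 * e) * (2 * f) + b * (2 * e)^2"
        by (simp add: power2_eq_square algebra_simps)
      also have "\<dots> = 0"
        unfolding *(2-) 2 by (simp add: algebra_simps power2_eq_square)
      finally show ?thesis
        using two unfolding mult_eq_0_iff by blast
    qed
  next
    assume R: ?R
    consider "d = 0" "e = 0"
      | "d \<noteq> 0 \<or> e \<noteq> 0" "r * c * d^2 - 2 * d * e * f + b * e^2 = 0"
      | "d \<noteq> 0 \<or> e \<noteq> 0" "q * p' * c * d^2 - 2 * d * e * f + p * r * q' * b * e^2 = 0"
      using R by auto
    then show ?L
    proof cases
      case 1
      obtain y1 z1 y2 z2 where "b = y1 * y2" "c = z1 * z2" "2 * f = y1 * z2 + r * z1 * y2"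
        using binary_quadratic_factors[OF \<open>r \<noteq> 0\<close>] by metis
      then show ?thesis
        using 1 by (intro exI[of _ 0] exI[of _ y1] exI[of _ z1] exI[of _ 0] exI[of _ y2] exI[of _ z2]) simp
    next
      case 2
      \<comment> \<open>This is the system for \<open>x1 = 1\<close>, \<open>x2 = 0\<close>, hence
        \<open>y2 = 2 * d\<close>, \<open>z2 = 2 * e\<close>. If \<open>d\<close> and
        \<open>e\<close> are nonzero, \<open>b\<close> and \<open>c\<close> determine
        \<open>y\<close> and \<open>z\<close>, and the vanishing factor is the last equation. If
        just one is zero, the factor forces \<open>b = 0\<close> or \<open>c = 0\<close>, which
        frees an unknown to solve the last equation.\<close>
      have "\<exists>y z. b = y * (2 * d) \<and> c = z * (2 * e) \<and> 2 * f = y * (2 * e) + r * z * (2 * d)"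
      proof -
        consider "d = 0" "e \<noteq> 0" "b = 0" | "d \<noteq> 0" "e = 0" "c = 0" | "d \<noteq> 0" "e \<noteq> 0"
          using 2 pqr by fastforce
        then show ?thesis
        proof cases
          case 1
          then show ?thesis
            using two by (intro exI[of _ "f / e"] exI[of _ "c / (2 * e)"]) simp
        next
          case 2
          then show ?thesis
            using two pqr by (intro exI[of _ "b / (2 * d)"] exI[of _ "f / (r * d)"]) simp
        next
          case 3
          have "2 * d * e * f = b * e^2 + r * c * d^2"
            using 2 by (simp add: algebra_simps eq_neg_iff_add_eq_0)
          then have "2 * f = b / (2 * d) * (2 * e) + r * (c / (2 * e)) * (2 * d)"
            using 3 two by (simp add: field_simps power2_eq_square)
          then show ?thesis
            using 3 two by (intro exI[of _ "b / (2 * d)"] exI[of _ "c / (2 * e)"]) simp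
        qed
      qed
      then obtain y z where "b = y * (2 * d)" "c = z * (2 * e)" "2 * f = y * (2 * e) + r * z * (2 * d)"
        by blast
      then show ?thesis
        by (intro exI[of _ 1] exI[of _ y] exI[of _ z] exI[of _ 0] exI[of _ "2 * d"] exI[of _ "2 * e"]) simp
    next
      case 3
      \<comment> \<open>The mirror case \<open>x1 = 0\<close>, \<open>x2 = 1\<close>, where
        \<open>y1 = 2 * d / p\<close> and \<open>z1 = 2 * e / q\<close>.\<close>
      have "\<exists>y z. b = (2 * d / p) * y \<and> c = (2 * e / q) * z \<and>
          2 * f = (2 * d / p) * z + r * (2 * e / q) * y"
      proof -
        consider "d = 0" "e \<noteq> 0" "b = 0" | "d \<noteq> 0" "e = 0" "c = 0" | "d \<noteq> 0" "e \<noteq> 0"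
          using 3 pqr by (fastforce simp: p')
        then show ?thesis
        proof cases
          case 1
          then show ?thesis
            using two pqr by (intro exI[of _ "f * q / (r * e)"] exI[of _ "q * c / (2 * e)"]) simp
        next
          case 2
          then show ?thesis
            using two pqr by (intro exI[of _ "p * b / (2 * d)"] exI[of _ "f * p / d"]) simp
        next
          case c: 3
          have "2 * d * e * f = p * r * q' * b * e^2 + q * p' * c * d^2"
            using 3 by (simp add: algebra_simps)
          then have "2 * f = (2 * d / p) * (q * c / (2 * e)) + r * (2 * e / q) * (p * b / (2 * d))"
            using c two pqr by (simp add: p' field_simps power2_eq_square)
          then show ?thesis
            using c two pqr by (intro exI[of _ "p * b / (2 * d)"] exI[of _ "q * c / (2 * e)"]) simp
        qed
      qed
      then obtain y z where "b = (2 * d / p) * y" "c = (2 * e / q) * z"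
          "2 * f = (2 * d / p) * z + r * (2 * e / q) * y"
        by blast
      then show ?thesis
        using pqr by (intro exI[of _ 0] exI[of _ "2 * d / p"] exI[of _ "2 * e / q"] exI[of _ 1]
            exI[of _ y] exI[of _ z]) simp
    qed
  qed
qed

lemma product_system_iff_nonzero:
  fixes a b c d e f p q r :: "'k::field"
  assumes "a \<noteq> 0" and inv: "p * p' = 1" "q * q' = 1"
  shows "(\<exists>x1 y1 z1 x2 y2 z2. a = x1 * x2 \<and> b = y1 * y2 \<and> c = z1 * z2 \<and>
            2 * d = x1 * y2 + p * y1 * x2 \<and> 2 * e = x1 * z2 + q * z1 * x2 \<and>
            2 * f = y1 * z2 + r * z1 * y2) \<longleftrightarrow>
    (\<exists>X Y. X^2 = d^2 - p * a * b \<and> Y^2 = e^2 - q * a * c \<and>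
      p' * (d + X) * (e - Y) + r * q' * (d - X) * (e + Y) - 2 * a * f = 0)"
    (is "?L \<longleftrightarrow> ?R")
proof
  assume ?L
  then obtain x1 y1 z1 x2 y2 z2 where *: "a = x1 * x2" "b = y1 * y2" "c = z1 * z2"
      "2 * d = x1 * y2 + p * y1 * x2" "2 * e = x1 * z2 + q * z1 * x2"
      "2 * f = y1 * z2 + r * z1 * y2"
    by blast
  \<comment> \<open>If \<open>s\<close> and \<open>t\<close> have sum \<open>2 * g\<close>, then
    \<open>s\<close> is a root of T^2 - 2 g T + s t; completing the square gives the claim. It is
    applied to the two summands of \<open>2 * d\<close> and of \<open>2 * e\<close>.\<close>
  have sq: "(s - g)^2 = g^2 - s * t" if "2 * g = t + s" for g s t :: 'k
  proof -
    have "(s - g)^2 = g^2 + s * s - s * (2 * g)"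
      by (simp add: power2_eq_square algebra_simps)
    then show ?thesis
      unfolding that by (simp add: algebra_simps)
  qed
  define X Y where "X = p * y1 * x2 - d" and "Y = q * z1 * x2 - e"
  have "X^2 = d^2 - p * a * b" "Y^2 = e^2 - q * a * c"
    using sq[OF *(4)] sq[OF *(5)] *(1-3) unfolding X_def Y_def by (simp_all add: ac_simps)
  moreover have "d + X = p * y1 * x2" "d - X = x1 * y2" "e + Y = q * z1 * x2" "e - Y = x1 * z2"
    using * unfolding X_def Y_def by (simp_all add: algebra_simps)
  then have "p' * (d + X) * (e - Y) + r * q' * (d - X) * (e + Y) - 2 * a * f =
      (p * p') * y1 * x2 * x1 * z2 + r * (q * q') * x1 * y2 * z1 * x2 - x1 * x2 * (2 * f)"
    using *(1) by simp
  then have "p' * (d + X) * (e - Y) + r * q' * (d - X) * (e + Y) - 2 * a * f = 0"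
    unfolding inv *(6) by (simp add: algebra_simps)
  ultimately show ?R
    by blast
next
  assume ?R
  then obtain X Y where *: "X^2 = d^2 - p * a * b" "Y^2 = e^2 - q * a * c"
      "p' * (d + X) * (e - Y) + r * q' * (d - X) * (e + Y) - 2 * a * f = 0"
    by blast
  have nz: "p \<noteq> 0" "q \<noteq> 0"
    using inv by auto
  then have p': "p' = 1 / p" "q' = 1 / q"
    using inv by (simp_all add: field_simps)
  \<comment> \<open>The witnesses come from the normalisation \<open>x1 = 1\<close>,
    \<open>x2 = a\<close>: then \<open>y2 = d - X\<close> and \<open>p * y1 * a = d + X\<close>, and
    similarly for \<open>z2\<close>, \<open>z1\<close> with \<open>e\<close>, \<open>Y\<close>,
    \<open>q\<close>. The equations for \<open>b\<close> and \<open>c\<close> restate the choice of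
    \<open>X\<close> and \<open>Y\<close>.\<close>
  have "b = (d + X) * (d - X) / (p * a)" "c = (e + Y) * (e - Y) / (q * a)"
    using * assms(1) nz by (simp_all add: field_simps power2_eq_square)
  moreover have "2 * f = (d + X) / (p * a) * (e - Y) + r * ((e + Y) / (q * a)) * (d - X)"
  proof -
    have "2 * a * f = 1 / p * (d + X) * (e - Y) + r * (1 / q) * (d - X) * (e + Y)"
      using *(3) unfolding p' by simp
    also have "\<dots> = a * ((d + X) / (p * a) * (e - Y) + r * ((e + Y) / (q * a)) * (d - X))"
      using assms(1) nz by (simp add: divide_simps)
    finally show ?thesis
      using assms(1) by (simp add: mult.assoc mult.left_commute[of 2])
  qed
  ultimately show ?L
    using assms(1) nz
    by (intro exI[of _ 1] exI[of _ "(d + X) / (p * a)"] exI[of _ "(e + Y) / (q * a)"] exI[of _ a]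
        exI[of _ "d - X"] exI[of _ "e - Y"]) simp
qed

section \<open>Linear forms and the degree-one part\<close>

definition linear_form :: "'k \<Rightarrow> 'k \<Rightarrow> 'k \<Rightarrow> (3, 'k::field) free_algebra"
  where "linear_form x y z = scalar x * gen 1 + scalar y * gen 2 + scalar z * gen 3"

lemma linear_form_eq_single:
  "linear_form x y z = Poly_Mapping.single (Word [1]) x + Poly_Mapping.single (Word [2]) y
    + Poly_Mapping.single (Word [3]) z"
  by (simp add: linear_form_def scalar_def gen_def mult_single zero_free_monoid_def
      plus_free_monoid_def)

lemma lookup_linear_form:
  "Poly_Mapping.lookup (linear_form x y z) (Word [1]) = x"
  "Poly_Mapping.lookup (linear_form x y z) (Word [2]) = y"
  "Poly_Mapping.lookup (linear_form x y z) (Word [3]) = z"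
  "Poly_Mapping.lookup (linear_form x y z) (Word []) = 0"
  by (simp_all add: linear_form_eq_single lookup_add lookup_single when_def)

lemma homogeneous_linear_form: "homogeneous 1 (linear_form x y z)"
  by (auto simp: homogeneous_def in_keys_iff linear_form_eq_single lookup_add lookup_single when_def
      split: if_splits)

lemma homogeneous_1_eq_linear_form:
  fixes p :: "(3, 'k::field) free_algebra"
  assumes "homogeneous 1 p"
  shows "p = linear_form (Poly_Mapping.lookup p (Word [1])) (Poly_Mapping.lookup p (Word [2]))
    (Poly_Mapping.lookup p (Word [3]))" (is "p = ?l")
proof (rule poly_mapping_eqI)
  fix u :: "3 free_monoid"
  show "Poly_Mapping.lookup p u = Poly_Mapping.lookup ?l u"
  proof (cases "length (letters u) = 1")
    case True
    then obtain i where "u = Word [i]"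
      by (cases u) (auto simp: length_Suc_conv)
    then show ?thesis
      using exhaust_3[of i] by (auto simp: lookup_linear_form)
  next
    case False
    then have "u \<notin> Poly_Mapping.keys p" "u \<notin> Poly_Mapping.keys ?l"
      using assms homogeneous_linear_form unfolding homogeneous_def by blast+
    then show ?thesis
      by (simp add: in_keys_iff)
  qed
qed

text \<open>This turns quantifiers over S_1 into quantifiers over scalars.\<close>

lemma bex_skew_part_1:
  "(\<exists>L \<in> skew_part \<mu> 1. P L) \<longleftrightarrow> (\<exists>x y z. P (skew_class \<mu> (linear_form x y z)))"
  unfolding skew_part_def bex_simps image_iff
  by (metis homogeneous_linear_form homogeneous_1_eq_linear_form mem_Collect_eq)

lemma homogeneous_times:
  fixes p q :: "('i, 'k::ring_1) free_algebra"
  assumes "homogeneous m p" "homogeneous n q"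
  shows "homogeneous (m + n) (p * q)"
proof -
  have "length (letters w) = m + n" if "w \<in> Poly_Mapping.keys (p * q)" for w
  proof -
    from subsetD[OF keys_mult that] obtain u v
      where "w = u + v" "u \<in> Poly_Mapping.keys p" "v \<in> Poly_Mapping.keys q"
      by blast
    then show ?thesis
      using assms by (simp add: homogeneous_def plus_free_monoid_def)
  qed
  then show ?thesis
    by (simp add: homogeneous_def)
qed

section \<open>From factorisations to scalar equations\<close>

lemma quadratic_form_eq_product_iff:
  fixes \<mu> :: "3 \<Rightarrow> 3 \<Rightarrow> 'k::field"
  assumes two: "(2::'k) \<noteq> 0" and diag: "\<And>i. \<mu> i i = 1" and inv: "\<And>i j. \<mu> i j * \<mu> j i = 1"
  shows "quadratic_form \<mu> a b c d e f =
      skew_class \<mu> (linear_form x1 y1 z1 * linear_form x2 y2 z2) \<longleftrightarrow>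
    a = x1 * x2 \<and> b = y1 * y2 \<and> c = z1 * z2 \<and> 2 * d = x1 * y2 + \<mu> 1 2 * y1 * x2 \<and>
    2 * e = x1 * z2 + \<mu> 1 3 * z1 * x2 \<and> 2 * f = y1 * z2 + \<mu> 2 3 * z1 * y2"
proof -
  define q :: "(3, 'k) free_algebra" where "q = scalar a * gen 1 ^ 2 + scalar b * gen 2 ^ 2
    + scalar c * gen 3 ^ 2 + scalar (2 * d) * gen 1 * gen 2 + scalar (2 * e) * gen 1 * gen 3
    + scalar (2 * f) * gen 2 * gen 3"
  let ?p = "linear_form x1 y1 z1 * linear_form x2 y2 z2"
  let ?s = "\<lambda>p i j. Poly_Mapping.lookup p (Word [i, j]) + \<mu> i j * Poly_Mapping.lookup p (Word [j, i])"
  have q: "q = Poly_Mapping.single (Word [1, 1]) a + Poly_Mapping.single (Word [2, 2]) b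
    + Poly_Mapping.single (Word [3, 3]) c + Poly_Mapping.single (Word [1, 2]) (2 * d)
    + Poly_Mapping.single (Word [1, 3]) (2 * e) + Poly_Mapping.single (Word [2, 3]) (2 * f)"
    by (simp add: q_def scalar_def gen_def mult_single power2_eq_square zero_free_monoid_def
        plus_free_monoid_def)
  have "homogeneous 2 q"
    by (auto simp: homogeneous_def in_keys_iff q lookup_add lookup_single when_def split: if_splits)
  moreover have "homogeneous 2 ?p"
    using homogeneous_times[OF homogeneous_linear_form homogeneous_linear_form]
    by (simp add: numeral_2_eq_2)
  ultimately have "skew_class \<mu> q = skew_class \<mu> ?p \<longleftrightarrow> (\<forall>i j. ?s q i j = ?s ?p i j)"
    by (rule skew_class_eq_iff_lookup[OF two inv])
  also have "\<dots> \<longleftrightarrow> ?s q 1 1 = ?s ?p 1 1 \<and> ?s q 2 2 = ?s ?p 2 2 \<and> ?s q 3 3 = ?s ?p 3 3 \<and>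
      ?s q 1 2 = ?s ?p 1 2 \<and> ?s q 1 3 = ?s ?p 1 3 \<and> ?s q 2 3 = ?s ?p 2 3"
  proof -
    \<comment> \<open>The functional at (j, i) is a multiple of the one at (i, j), which leaves six
      of the nine equations.\<close>
    have swap: "?s p j i = \<mu> j i * ?s p i j" for p i j
      using inv[of j i] by (simp add: distrib_left mult.assoc[symmetric])
    have "?s q j i = ?s ?p j i" if "?s q i j = ?s ?p i j" for i j
      unfolding swap[of _ j i] that ..
    then show ?thesis
      unfolding forall_3 by blast
  qed
  also have "\<dots> \<longleftrightarrow> a = x1 * x2 \<and> b = y1 * y2 \<and> c = z1 * z2 \<and>
      2 * d = x1 * y2 + \<mu> 1 2 * y1 * x2 \<and> 2 * e = x1 * z2 + \<mu> 1 3 * z1 * x2 \<and>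
      2 * f = y1 * z2 + \<mu> 2 3 * z1 * y2"
    \<comment> \<open>On the diagonal \<mu> i i = 1, so the functional is twice the coefficient and
      the 2 cancels.\<close>
    using two
    by (simp add: diag lookup_times_Word_le2 lookup_linear_form q lookup_add lookup_single mult.assoc)
  finally show ?thesis
    unfolding quadratic_form_def q_def .
qed

section \<open>Squares and products in S\<close>

theorem theorem3p3:
  fixes \<mu> :: "3 \<Rightarrow> 3 \<Rightarrow> 'k::alg_closed_field"
    and a b c d e f :: 'k
    and S :: "(3, 'k) free_algebra set ring"
    and Q :: "(3, 'k) free_algebra set"
    and M :: "'k ^ 3 ^ 3"
  assumes "CHAR('k) \<noteq> 2"
    and "\<And>i j. \<mu> i j \<noteq> 0"
    and "\<And>i. \<mu> i i = 1"
    and "\<And>i j. \<mu> i j * \<mu> j i = 1"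
    and "S = skew_algebra \<mu>"
    and "Q = quadratic_form \<mu> a b c d e f"
    and "M = mu_symmetric_matrix \<mu> a b c d e f"
  shows
    "((\<exists>L \<in> skew_part \<mu> 1. Q = L [^]\<^bsub>S\<^esub> (2::nat)) \<longleftrightarrow>
        D1 \<mu> M = 0 \<and> D2 \<mu> M = 0 \<and> D3 \<mu> M = 0 \<and> D4 \<mu> M = 0 \<and> D5 \<mu> M = 0 \<and> D6 \<mu> M = 0)
     \<and> (a = 0 \<longrightarrow>
        ((\<exists>L1 \<in> skew_part \<mu> 1. \<exists>L2 \<in> skew_part \<mu> 1. Q = L1 \<otimes>\<^bsub>S\<^esub> L2) \<longleftrightarrow> D7 \<mu> M = 0))
     \<and> (a \<noteq> 0 \<longrightarrow>
        ((\<exists>L1 \<in> skew_part \<mu> 1. \<exists>L2 \<in> skew_part \<mu> 1. Q = L1 \<otimes>\<^bsub>S\<^esub> L2) \<longleftrightarrow>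
         (\<exists>X Y. X^2 = d^2 - \<mu> 1 2 * a * b \<and> Y^2 = e^2 - \<mu> 1 3 * a * c \<and> D8 \<mu> M X Y = 0)))"
proof -
  have two: "(2::'k) \<noteq> 0"
    by (rule two_neq_0) (rule assms(1))
  note product_iff = quadratic_form_eq_product_iff[of \<mu>, OF two assms(3) assms(4)]
  note D = assms(7) mu_symmetric_matrix_def Let_def
  \<comment> \<open>With equal factors the two summands of each mixed term merge, which produces the
    coefficients 1 + \<mu> i j.\<close>
  have "(\<exists>L \<in> skew_part \<mu> 1. Q = L [^]\<^bsub>S\<^esub> (2::nat)) \<longleftrightarrow>
      (\<exists>x y z. a = x^2 \<and> b = y^2 \<and> c = z^2 \<and> 2 * d = (1 + \<mu> 1 2) * x * y \<and>
        2 * e = (1 + \<mu> 1 3) * x * z \<and> 2 * f = (1 + \<mu> 2 3) * y * z)"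
    unfolding assms(5,6) bex_skew_part_1 skew_class_power2 product_iff
    by (simp add: power2_eq_square distrib_left distrib_right ac_simps)
  also have "\<dots> \<longleftrightarrow>
      D1 \<mu> M = 0 \<and> D2 \<mu> M = 0 \<and> D3 \<mu> M = 0 \<and> D4 \<mu> M = 0 \<and> D5 \<mu> M = 0 \<and> D6 \<mu> M = 0"
    unfolding square_system_iff[OF two]
    by (simp add: D D1_def D2_def D3_def D4_def D5_def D6_def vector_3)
  finally have square: "(\<exists>L \<in> skew_part \<mu> 1. Q = L [^]\<^bsub>S\<^esub> (2::nat)) \<longleftrightarrow>
      D1 \<mu> M = 0 \<and> D2 \<mu> M = 0 \<and> D3 \<mu> M = 0 \<and> D4 \<mu> M = 0 \<and> D5 \<mu> M = 0 \<and> D6 \<mu> M = 0" .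
  have product: "(\<exists>L1 \<in> skew_part \<mu> 1. \<exists>L2 \<in> skew_part \<mu> 1. Q = L1 \<otimes>\<^bsub>S\<^esub> L2) \<longleftrightarrow>
      (\<exists>x1 y1 z1 x2 y2 z2. a = x1 * x2 \<and> b = y1 * y2 \<and> c = z1 * z2 \<and>
        2 * d = x1 * y2 + \<mu> 1 2 * y1 * x2 \<and> 2 * e = x1 * z2 + \<mu> 1 3 * z1 * x2 \<and>
        2 * f = y1 * z2 + \<mu> 2 3 * z1 * y2)"
    unfolding assms(5,6) bex_skew_part_1 skew_class_mult product_iff by (rule refl)
  have "(\<exists>L1 \<in> skew_part \<mu> 1. \<exists>L2 \<in> skew_part \<mu> 1. Q = L1 \<otimes>\<^bsub>S\<^esub> L2) \<longleftrightarrow> D7 \<mu> M = 0"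
    if "a = 0"
    unfolding product that
      product_system_iff_0[OF two assms(2) assms(2) assms(2) assms(4) assms(4)]
    by (simp add: D D7_def vector_3)
  moreover have "(\<exists>L1 \<in> skew_part \<mu> 1. \<exists>L2 \<in> skew_part \<mu> 1. Q = L1 \<otimes>\<^bsub>S\<^esub> L2) \<longleftrightarrow>
      (\<exists>X Y. X^2 = d^2 - \<mu> 1 2 * a * b \<and> Y^2 = e^2 - \<mu> 1 3 * a * c \<and> D8 \<mu> M X Y = 0)"
    if "a \<noteq> 0"
    unfolding product product_system_iff_nonzero[OF that assms(4) assms(4)]
    by (simp add: D D8_def vector_3)
  ultimately show ?thesis
    using square by blast
qed

end
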